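(* Let $G_1=(V_1,E_1)$ be a $d$-regular HS graph, let $\alpha\ge 1$ be an integer, and let $G$ be the composite graph consisting of $\alpha$ copies of $G_1$ glued at a single common vertex $c$. Let $K$ and $K_1$ be the Kemeny constants of $G$ and $G_1$, respectively. Then $$K=(2\alpha-1)K_1.$$
   Context: All graphs are finite, simple, connected and undirected, with at least two vertices. The simple random walk on a graph $H=(V,E)$ is the Markov chain $(X_k)_{k\ge 0}$ that jumps from a vertex to a uniformly chosen neighbor. Its stationary distribution is $\pi_i=\frac{d_i}{2|E|}$, where $d_i$ is the degree of $i$. The hitting time of a vertex $b$ is $T_b=\inf\{k\ge 0: X_k=b\}$, and $E_aT_b$ is its expectation when the walk starts at $a$ (so $E_aT_a=0$). The Kemeny constant of $H$ is $\sum_{j\in V}\pi_jE_iT_j$, which is independent of $i$. A graph is called HS (highly symmetric) if $E_aT_b=E_bT_a$ for all vertices $a,b$. Composite graph: given $G_1=(V_1,E_1)$, fix a vertex $c\in V_1$; $G=(V,E)$ is obtained from $\alpha$ disjoint copies of $G_1$ by identifying the $\alpha$ copies of $c$ into a single vertex, again called $c$. Thus $|E|=\alpha|E_1|$ and $|V|=\alpha(|V_1|-1)+1$. *)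

theory Defs
  imports "HOL-Probability.Probability" "Graph_Theory.Graph_Theory"
begin

text \<open>
  A simple undirected graph is a \<open>pair_graph\<close>: every edge \<open>{u, v}\<close> is represented by the two
  arcs \<open>(u, v)\<close> and \<open>(v, u)\<close>, so that the degree of a vertex is its \<open>out_degree\<close>.
\<close>

definition finite_simple_connected_graph :: "'a pair_pre_digraph \<Rightarrow> bool" where
  "finite_simple_connected_graph G \<longleftrightarrow>
     pair_graph G \<and> Digraph_Component.connected (with_proj G) \<and> 2 \<le> card (pverts G)"

definition edges :: "'a pair_pre_digraph \<Rightarrow> 'a set set" where
  "edges G = {{u, v} |u v. (u, v) \<in> parcs G}"

definition neighbors :: "'a pair_pre_digraph \<Rightarrow> 'a \<Rightarrow> 'a set" where
  "neighbors G v = {w. (v, w) \<in> parcs G}"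

abbreviation vdegree :: "'a pair_pre_digraph \<Rightarrow> 'a \<Rightarrow> nat" where
  "vdegree G v \<equiv> out_degree (with_proj G) v"

definition regular :: "nat \<Rightarrow> 'a pair_pre_digraph \<Rightarrow> bool" where
  "regular d G \<longleftrightarrow> (\<forall>v\<in>pverts G. vdegree G v = d)"

text \<open>
  The simple random walk is realised on the space of i.i.d. sequences of random maps. Each map
  independently sends every vertex to a uniformly chosen neighbor, and the walk at time \<open>k\<close>
  moves according to the \<open>k\<close>-th map. Lemma \<open>prob_walk_path\<close> below gives the resulting
  finite-dimensional distributions. The factors are measures on the finite neighbor sets (rather
  than \<open>pmf\<close>s, whose space is the whole type), so that the walk is measurable for every vertex
  type.
\<close>

definition step_space :: "'a pair_pre_digraph \<Rightarrow> ('a \<Rightarrow> 'a) measure" where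
  "step_space G = PiM (pverts G) (\<lambda>v. uniform_count_measure (neighbors G v))"

definition walk_space :: "'a pair_pre_digraph \<Rightarrow> ('a \<Rightarrow> 'a) stream measure" where
  "walk_space G = stream_space (step_space G)"

primrec walk :: "'a \<Rightarrow> ('a \<Rightarrow> 'a) stream \<Rightarrow> nat \<Rightarrow> 'a" where
  "walk a \<omega> 0 = a"
| "walk a \<omega> (Suc k) = (\<omega> !! k) (walk a \<omega> k)"

text \<open>The infimum of the empty set is \<open>\<infinity>\<close> in \<open>enat\<close>.\<close>

definition hitting_time :: "(nat \<Rightarrow> 'a) \<Rightarrow> 'a \<Rightarrow> enat" where
  "hitting_time X b = Inf {enat k |k. X k = b}"

definition expected_hitting_time :: "'a pair_pre_digraph \<Rightarrow> 'a \<Rightarrow> 'a \<Rightarrow> ennreal" where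
  "expected_hitting_time G a b =
     (\<integral>\<^sup>+\<omega>. ennreal_of_enat (hitting_time (walk a \<omega>) b) \<partial>walk_space G)"

definition highly_symmetric :: "'a pair_pre_digraph \<Rightarrow> bool" where
  "highly_symmetric G \<longleftrightarrow>
     (\<forall>a\<in>pverts G. \<forall>b\<in>pverts G. expected_hitting_time G a b = expected_hitting_time G b a)"

definition stationary :: "'a pair_pre_digraph \<Rightarrow> 'a \<Rightarrow> real" where
  "stationary G i = real (vdegree G i) / (2 * real (card (edges G)))"

text \<open>
  The sum defining the Kemeny constant does not depend on the starting vertex \<open>i\<close>, which is
  kept as a parameter instead of being chosen.
\<close>

definition kemeny :: "'a pair_pre_digraph \<Rightarrow> 'a \<Rightarrow> ennreal" where
  "kemeny G i = (\<Sum>j\<in>pverts G. ennreal (stationary G j) * expected_hitting_time G i j)"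

text \<open>
  Vertex \<open>v\<close> of the \<open>k\<close>-th copy is \<open>(k, v)\<close>, except that all copies of \<open>c\<close> are identified
  with \<open>(0, c)\<close>.
\<close>

definition glue :: "'a \<Rightarrow> nat \<Rightarrow> 'a \<Rightarrow> nat \<times> 'a" where
  "glue c k v = (if v = c then (0, c) else (k, v))"

definition composite :: "'a pair_pre_digraph \<Rightarrow> 'a \<Rightarrow> nat \<Rightarrow> (nat \<times> 'a) pair_pre_digraph" where
  "composite G c \<alpha> =
     \<lparr> pverts = {glue c k v |k v. k < \<alpha> \<and> v \<in> pverts G},
       parcs = {(glue c k u, glue c k v) |k u v. k < \<alpha> \<and> (u, v) \<in> parcs G} \<rparr>"


subsection \<open>Basic facts about the walk\<close>

lemma strongly_connected_graph:
  assumes "finite_simple_connected_graph G"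
  shows "pair_graph G" "strongly_connected (with_proj G)"
proof -
  show "pair_graph G" using assms by (simp add: finite_simple_connected_graph_def)
  then interpret pair_graph G .
  show "strongly_connected (with_proj G)"
    using symmetric_connected_imp_strongly_connected sym_arcs assms
    by (simp add: finite_simple_connected_graph_def)
qed

lemma neighbors_props:
  assumes "finite_simple_connected_graph G" and "v \<in> pverts G"
  shows "finite (neighbors G v)" "neighbors G v \<noteq> {}" "neighbors G v \<subseteq> pverts G"
    and "card (neighbors G v) = vdegree G v"
proof -
  interpret pair_graph G using strongly_connected_graph(1)[OF assms(1)] .
  have "neighbors G v = snd ` {e \<in> parcs G. fst e = v}"
    by (force simp: neighbors_def)
  then show "finite (neighbors G v)" using pair_finite_arcs by simp
  show "neighbors G v \<subseteq> pverts G" by (auto simp: neighbors_def dest: in_arcsD2)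
  have "bij_betw snd {e \<in> parcs G. fst e = v} (neighbors G v)"
    by (rule bij_betwI[where g = "Pair v"]) (auto simp: neighbors_def)
  then show "card (neighbors G v) = vdegree G v"
    by (simp add: out_degree_def out_arcs_def bij_betw_same_card)
  have "\<not> pverts G \<subseteq> {v}"
    using assms(1) card_mono[of "{v}" "pverts G"]
    by (auto simp: finite_simple_connected_graph_def)
  then obtain w where w: "w \<in> pverts G" "w \<noteq> v" by auto
  have "v \<rightarrow>\<^sup>*\<^bsub>with_proj G\<^esub> w"
    using strongly_connected_graph(2)[OF assms(1)] assms(2) w(1)
    by (simp add: strongly_connected_def)
  then have "(v, w) \<in> (parcs G)\<^sup>+" using w(2) by (auto dest: reachable_neq_reachable1)
  then obtain u where "(v, u) \<in> parcs G" by (meson converse_tranclE)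
  then show "neighbors G v \<noteq> {}" by (auto simp: neighbors_def)
qed

lemma prob_space_step:
  assumes "finite_simple_connected_graph G"
  shows "prob_space (step_space G)"
  unfolding step_space_def
  by (intro prob_space_PiM prob_space_uniform_count_measure neighbors_props assms)

lemma prob_space_walk_space:
  assumes "finite_simple_connected_graph G"
  shows "prob_space (walk_space G)"
  unfolding walk_space_def by (rule prob_space.prob_space_stream_space[OF prob_space_step[OF assms]])

lemma walk_Stream: "walk a (f ## \<omega>) (Suc k) = walk (f a) \<omega> k"
  by (induction k) auto

lemma measurable_step:
  assumes "finite_simple_connected_graph G" and "v \<in> pverts G"
  shows "(\<lambda>f. f v) \<in> step_space G \<rightarrow>\<^sub>M count_space (pverts G)"
proof -
  have "(\<lambda>f. f v) \<in> step_space G \<rightarrow>\<^sub>M uniform_count_measure (neighbors G v)"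
    unfolding step_space_def using assms by measurable
  then have "(\<lambda>f. f v) \<in> step_space G \<rightarrow>\<^sub>M count_space (neighbors G v)"
    by (subst (asm) measurable_cong_sets[OF refl sets_uniform_count_measure_count_space])
  moreover have "(\<lambda>x. x) \<in> count_space (neighbors G v) \<rightarrow>\<^sub>M count_space (pverts G)"
    using neighbors_props(3)[OF assms] by auto
  ultimately show ?thesis by (rule measurable_compose)
qed

lemma measurable_walk:
  assumes "finite_simple_connected_graph G" and "a \<in> pverts G"
  shows "(\<lambda>\<omega>. walk a \<omega> k) \<in> walk_space G \<rightarrow>\<^sub>M count_space (pverts G)"
proof (induction k)
  case 0
  then show ?case using assms by simp
next
  case (Suc k)
  have "countable (pverts G)"
    using assms(1) by (intro countable_finite card_ge_0_finite)
      (simp add: finite_simple_connected_graph_def)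
  moreover have "(\<lambda>\<omega>. (\<omega> !! k) v) \<in> walk_space G \<rightarrow>\<^sub>M count_space (pverts G)"
    if "v \<in> pverts G" for v
    unfolding walk_space_def
    by (rule measurable_compose[OF measurable_snth measurable_step[OF assms(1) that]])
  ultimately show ?case
    using measurable_compose_countable'[OF _ Suc, of "\<lambda>v \<omega>. (\<omega> !! k) v"] by simp
qed

lemma ennreal_hitting_time:
  "ennreal_of_enat (hitting_time X b) = (INF k. if X k = b then of_nat k else \<top>)"
proof (cases "\<exists>k. X k = b")
  case True
  define m where "m = (LEAST k. X k = b)"
  have m: "X m = b" "\<And>k. X k = b \<Longrightarrow> m \<le> k"
    using True by (auto simp: m_def intro: LeastI_ex Least_le)
  have "hitting_time X b = enat m"
    unfolding hitting_time_def using m by (intro Inf_eqI) auto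
  moreover have "(INF k. if X k = b then of_nat k else \<top>) = (of_nat m :: ennreal)"
  proof (rule antisym)
    show "(INF k. if X k = b then of_nat k else \<top>) \<le> (of_nat m :: ennreal)"
      by (rule INF_lower2[of m]) (simp_all add: m(1))
    show "(of_nat m :: ennreal) \<le> (INF k. if X k = b then of_nat k else \<top>)"
      by (rule INF_greatest) (simp add: m(2))
  qed
  ultimately show ?thesis by simp
next
  case False
  then have "{enat k |k. X k = b} = {}" by auto
  then show ?thesis using False by (simp add: hitting_time_def Inf_enat_def)
qed

lemma measurable_hitting_time:
  assumes "finite_simple_connected_graph G" and "a \<in> pverts G"
  shows "(\<lambda>\<omega>. ennreal_of_enat (hitting_time (walk a \<omega>) b)) \<in> borel_measurable (walk_space G)"
proof -
  have "(\<lambda>\<omega>. if walk a \<omega> k = b then of_nat k else \<top> :: ennreal)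
          \<in> borel_measurable (walk_space G)" for k
    by (rule measurable_compose[OF measurable_walk[OF assms]]) simp
  then show ?thesis unfolding ennreal_hitting_time by measurable
qed

lemma prob_step:
  assumes "finite_simple_connected_graph G" and "(v, w) \<in> parcs G"
  shows "emeasure (step_space G) {f \<in> space (step_space G). f v = w} = ennreal (1 / vdegree G v)"
proof -
  interpret pair_graph G using strongly_connected_graph(1)[OF assms(1)] .
  let ?U = "\<lambda>v. uniform_count_measure (neighbors G v)"
  have v: "v \<in> pverts G" and w: "w \<in> neighbors G v"
    using assms(2) by (auto simp: neighbors_def dest: in_arcsD1)
  have "emeasure (step_space G) {f \<in> space (step_space G). f v = w}
      = emeasure (distr (step_space G) (?U v) (\<lambda>f. f v)) {w}"
    unfolding step_space_def using v w
    by (subst emeasure_distr)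
       (auto intro!: arg_cong[where f = "emeasure _"] measurable_component_singleton
             simp: sets_uniform_count_measure)
  also have "distr (step_space G) (?U v) (\<lambda>f. f v) = ?U v"
    unfolding step_space_def
    by (rule distr_PiM_component)
       (intro prob_space_uniform_count_measure neighbors_props assms v | assumption)+
  also have "emeasure (?U v) {w} = ennreal (1 / vdegree G v)"
    using w neighbors_props[OF assms(1) v] by (subst emeasure_uniform_count_measure) auto
  finally show ?thesis .
qed

lemma prob_walk_path:
  assumes G: "finite_simple_connected_graph G"
    and "x 0 \<in> pverts G" and "\<And>k. k < n \<Longrightarrow> (x k, x (Suc k)) \<in> parcs G"
  shows "emeasure (walk_space G) {\<omega> \<in> space (walk_space G). \<forall>k\<le>n. walk (x 0) \<omega> k = x k}
           = ennreal (\<Prod>k<n. 1 / vdegree G (x k))"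
  using assms(2,3)
proof (induction n arbitrary: x)
  case 0
  then show ?case using prob_space.emeasure_space_1[OF prob_space_walk_space[OF G]] by simp
next
  case (Suc n)
  interpret pair_graph G using strongly_connected_graph(1)[OF G] .
  interpret S: prob_space "step_space G" using prob_space_step[OF G] .
  let ?E = "\<lambda>n x. {\<omega> \<in> space (walk_space G). \<forall>k\<le>n. walk (x 0) \<omega> k = x k}"
  let ?y = "\<lambda>k. x (Suc k)"
  have arc: "(x 0, ?y 0) \<in> parcs G" using Suc.prems(2)[of 0] by simp
  have y0: "?y 0 \<in> pverts G" using arc by (rule in_arcsD2)
  have meas: "?E (Suc n) x \<in> sets (walk_space G)"
  proof -
    have "{\<omega> \<in> space (walk_space G). walk (x 0) \<omega> k = x k} \<in> sets (walk_space G)" for k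
    proof -
      have "{v \<in> pverts G. v = x k} \<in> sets (count_space (pverts G))" by auto
      from measurable_sets[OF measurable_walk[OF G Suc.prems(1)] this, of k]
      have "(\<lambda>\<omega>. walk (x 0) \<omega> k) -` {v \<in> pverts G. v = x k} \<inter> space (walk_space G)
              \<in> sets (walk_space G)" .
      also have "(\<lambda>\<omega>. walk (x 0) \<omega> k) -` {v \<in> pverts G. v = x k} \<inter> space (walk_space G)
          = {\<omega> \<in> space (walk_space G). walk (x 0) \<omega> k = x k}"
        using measurable_space[OF measurable_walk[OF G Suc.prems(1)]] by auto
      finally show ?thesis .
    qed
    then show ?thesis by (intro sets.sets_Collect_countable_All) (auto intro: sets.sets_Collect)
  qed
  have split: "f ## \<omega> \<in> ?E (Suc n) x \<longleftrightarrow> f (x 0) = ?y 0 \<and> \<omega> \<in> ?E n ?y"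
    if "f \<in> space (step_space G)" "\<omega> \<in> space (walk_space G)" for f \<omega>
  proof -
    have "(\<forall>k\<le>Suc n. walk (x 0) (f ## \<omega>) k = x k) \<longleftrightarrow> (\<forall>k\<le>n. walk (f (x 0)) \<omega> k = ?y k)"
    proof (intro iffI allI impI)
      fix k assume "\<forall>k\<le>Suc n. walk (x 0) (f ## \<omega>) k = x k" and "k \<le> n"
      then have "walk (x 0) (f ## \<omega>) (Suc k) = x (Suc k)" by blast
      then show "walk (f (x 0)) \<omega> k = ?y k" by (simp only: walk_Stream)
    next
      fix k assume "\<forall>k\<le>n. walk (f (x 0)) \<omega> k = ?y k" and "k \<le> Suc n"
      then show "walk (x 0) (f ## \<omega>) k = x k"
        by (cases k) (simp_all only: walk_Stream walk.simps(1) Suc_le_mono)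
    qed
    moreover have "f (x 0) = ?y 0" if "\<forall>k\<le>n. walk (f (x 0)) \<omega> k = ?y k"
      using that by (auto dest: spec[of _ 0])
    moreover have "f ## \<omega> \<in> space (walk_space G)"
      using that by (simp add: walk_space_def space_stream_space streams_Stream)
    ultimately show ?thesis using that(2) by auto
  qed
  have "emeasure (walk_space G) (?E (Suc n) x)
      = (\<integral>\<^sup>+f. emeasure (walk_space G) {\<omega> \<in> space (walk_space G). f ## \<omega> \<in> ?E (Suc n) x}
           \<partial>step_space G)"
    unfolding walk_space_def
    by (rule S.emeasure_stream_space) (use meas in \<open>simp only: walk_space_def\<close>)
  also have "\<dots> = (\<integral>\<^sup>+f. emeasure (walk_space G) (?E n ?y) *
                 indicator {f \<in> space (step_space G). f (x 0) = ?y 0} f \<partial>step_space G)"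
  proof (rule nn_integral_cong)
    fix f assume f: "f \<in> space (step_space G)"
    have "{\<omega> \<in> space (walk_space G). f ## \<omega> \<in> ?E (Suc n) x}
        = (if f (x 0) = ?y 0 then ?E n ?y else {})"
      using split[OF f] by auto
    then show "emeasure (walk_space G) {\<omega> \<in> space (walk_space G). f ## \<omega> \<in> ?E (Suc n) x}
        = emeasure (walk_space G) (?E n ?y) *
            indicator {f \<in> space (step_space G). f (x 0) = ?y 0} f"
      using f by auto
  qed
  also have "\<dots> = emeasure (walk_space G) (?E n ?y) * ennreal (1 / vdegree G (x 0))"
  proof (subst nn_integral_cmult_indicator)
    have "(\<lambda>f. f (x 0)) -` {?y 0} \<inter> space (step_space G) \<in> sets (step_space G)"
      using measurable_sets[OF measurable_step[OF G Suc.prems(1)], of "{?y 0}"] y0 by simp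
    then show "{f \<in> space (step_space G). f (x 0) = ?y 0} \<in> sets (step_space G)"
      by (simp add: vimage_def Int_def conj_commute)
  qed (simp add: prob_step[OF G arc])
  also have "emeasure (walk_space G) (?E n ?y) = ennreal (\<Prod>k<n. 1 / vdegree G (?y k))"
    using Suc.IH[of ?y] y0 Suc.prems(2) by simp
  also have "\<dots> * ennreal (1 / vdegree G (x 0)) = ennreal (\<Prod>k<Suc n. 1 / vdegree G (x k))"
    by (subst prod.lessThan_Suc_shift) (simp add: ennreal_mult'[symmetric] mult.commute prod_nonneg
        del: prod.lessThan_Suc)
  finally show ?case .
qed

subsection \<open>Basic facts about the composite graph\<close>

lemma glue_inj: "glue c k u = glue c k v \<longleftrightarrow> u = v"
  by (auto simp: glue_def split: if_splits)

lemma composite_graph: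
  assumes G: "finite_simple_connected_graph G" and c: "c \<in> pverts G" and \<alpha>: "1 \<le> \<alpha>"
  shows finite_simple_connected_graph_composite:
      "finite_simple_connected_graph (composite G c \<alpha>)" (is ?thesis1)
    and card_pverts_composite:
      "card (pverts (composite G c \<alpha>)) = \<alpha> * (card (pverts G) - 1) + 1" (is ?thesis2)
    and card_edges_composite:
      "card (edges (composite G c \<alpha>)) = \<alpha> * card (edges G)" (is ?thesis3)
proof -
  interpret pair_graph G using strongly_connected_graph(1)[OF G] .
  let ?H = "composite G c \<alpha>"
  have V: "pverts ?H = insert (0, c) ({..<\<alpha>} \<times> (pverts G - {c}))"
  proof (intro equalityI subsetI)
    fix x assume "x \<in> insert (0, c) ({..<\<alpha>} \<times> (pverts G - {c}))"
    then consider "x = (0, c)" | k v where "x = (k, v)" "k < \<alpha>" "v \<in> pverts G" "v \<noteq> c"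
      by auto
    then have "\<exists>k v. x = glue c k v \<and> k < \<alpha> \<and> v \<in> pverts G"
    proof cases
      case 1
      then have "x = glue c 0 c \<and> 0 < \<alpha> \<and> c \<in> pverts G" using c \<alpha> by (simp add: glue_def)
      then show ?thesis by blast
    next
      case (2 k v)
      then have "x = glue c k v \<and> k < \<alpha> \<and> v \<in> pverts G" by (simp add: glue_def)
      then show ?thesis by blast
    qed
    then show "x \<in> pverts ?H" by (simp add: composite_def)
  qed (auto simp: composite_def glue_def split: if_splits)
  have A: "parcs ?H = (\<Union>k<\<alpha>. map_prod (glue c k) (glue c k) ` parcs G)"
    by (force simp: composite_def)
  show card: ?thesis2
    unfolding V using c pair_finite_verts
    by (subst card_insert_disjoint) (auto simp: card_cartesian_product card_Diff_singleton)
  have mem: "glue c k v \<in> pverts ?H" if "k < \<alpha>" "v \<in> pverts G" for k v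
    using that by (auto simp: composite_def)
  have arc: "(glue c k u, glue c k v) \<in> parcs ?H" if "k < \<alpha>" "(u, v) \<in> parcs G" for k u v
    using that by (auto simp: composite_def)
  have arcE: "\<exists>k u v. e = (glue c k u, glue c k v) \<and> k < \<alpha> \<and> (u, v) \<in> parcs G"
    if "e \<in> parcs ?H" for e
    using that by (auto simp: composite_def)
  interpret H: pair_graph ?H
  proof
    fix e assume "e \<in> parcs ?H"
    then obtain k u v where e: "e = (glue c k u, glue c k v)" and k: "k < \<alpha>"
      and uv: "(u, v) \<in> parcs G" using arcE by blast
    show "fst e \<in> pverts ?H" "snd e \<in> pverts ?H"
      using mem[OF k in_arcsD1[OF uv]] mem[OF k in_arcsD2[OF uv]] by (simp_all add: e)
  next
    fix e assume "e \<in> parcs ?H"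
    then show "fst e \<noteq> snd e"
      using arcE[of e] by (auto simp: glue_inj dest: no_loops')
  next
    show "symmetric (with_proj ?H)"
      unfolding symmetric_def with_proj_simps
    proof (rule symI)
      fix x y assume "(x, y) \<in> parcs ?H"
      then obtain k u v where "x = glue c k u" "y = glue c k v" "k < \<alpha>" "(u, v) \<in> parcs G"
        using arcE by blast
      then show "(y, x) \<in> parcs ?H" using arc[OF _ arcs_symmetric] by simp
    qed
  qed (simp_all add: V A pair_finite_verts pair_finite_arcs)
  have reach: "glue c k u \<rightarrow>\<^sup>*\<^bsub>with_proj ?H\<^esub> glue c k v"
    if "u \<rightarrow>\<^sup>*\<^bsub>with_proj G\<^esub> v" and k: "k < \<alpha>" for k u v
    using that(1)
  proof (induction rule: reachable_induct)
    case base
    then show ?case using k by (auto intro: mem)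
  next
    case (step x y)
    have "(glue c k x, glue c k y) \<in> parcs ?H"
      using step(2) k by (auto intro: arc)
    then show ?case using step.IH by (meson H.reachable_adj_trans)
  qed
  have sc: "u \<rightarrow>\<^sup>*\<^bsub>with_proj G\<^esub> v" if "u \<in> pverts G" "v \<in> pverts G" for u v
    using strongly_connected_graph(2)[OF G] that by (simp add: strongly_connected_def)
  have to_c: "x \<rightarrow>\<^sup>*\<^bsub>with_proj ?H\<^esub> (0, c)" if x: "x \<in> pverts ?H" for x
  proof -
    obtain k v where kv: "x = glue c k v" "k < \<alpha>" "v \<in> pverts G"
      using x by (auto simp: composite_def)
    then show ?thesis using reach[OF sc[OF kv(3) c] kv(2)] by (simp add: glue_def)
  qed
  have "strongly_connected (with_proj ?H)"
  proof (rule strongly_connectedI)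
    show "verts (with_proj ?H) \<noteq> {}" by (simp add: V)
    fix x y assume "x \<in> verts (with_proj ?H)" "y \<in> verts (with_proj ?H)"
    then show "x \<rightarrow>\<^sup>*\<^bsub>with_proj ?H\<^esub> y"
      using H.reachable_trans[OF to_c H.symmetric_reachable'[OF to_c]] by simp
  qed
  then have "Digraph_Component.connected (with_proj ?H)"
    using H.reachable_mk_symmetric_eq[OF H.sym_arcs]
    by (simp add: Digraph_Component.connected_def strongly_connected_def)
  moreover have "2 \<le> card (pverts ?H)"
  proof -
    have "2 \<le> card (pverts G)" using G by (simp add: finite_simple_connected_graph_def)
    then have "1 \<le> card (pverts G) - 1" by linarith
    then show ?thesis unfolding card using mult_le_mono[OF \<alpha>, of 1 "card (pverts G) - 1"] by simp
  qed
  ultimately show ?thesis1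
    using H.pair_graph by (simp add: finite_simple_connected_graph_def)
  have "inj_on (\<lambda>(k, e). glue c k ` e) ({..<\<alpha>} \<times> edges G)"
  proof (rule inj_onI, clarify)
    fix k e l f assume e: "e \<in> edges G" and f: "f \<in> edges G" and eq: "glue c k ` e = glue c l ` f"
    obtain u w where uw: "e = {u, w}" "(u, w) \<in> parcs G" using e by (auto simp: edges_def)
    then have "u \<noteq> w" by (blast dest: no_loops')
    then obtain v where v: "v \<in> e" "v \<noteq> c" using uw(1) by blast
    have "glue c k v \<in> glue c l ` f" using v(1) eq by blast
    then obtain v' where "glue c k v = glue c l v'" by blast
    then have "k = l" using v(2) by (simp add: glue_def split: if_splits)
    moreover have "inj (glue c l)" by (simp add: inj_def glue_inj)
    ultimately show "k = l \<and> e = f" using eq by (simp add: inj_image_eq_iff)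
  qed
  moreover have "edges ?H = (\<lambda>(k, e). glue c k ` e) ` ({..<\<alpha>} \<times> edges G)"
  proof (intro equalityI subsetI)
    fix e assume "e \<in> edges ?H"
    then obtain x y where xy: "e = {x, y}" "(x, y) \<in> parcs ?H" by (auto simp: edges_def)
    then obtain k u v where "e = glue c k ` {u, v}" "k < \<alpha>" "(u, v) \<in> parcs G"
      using arcE[OF xy(2)] by auto
    then show "e \<in> (\<lambda>(k, e). glue c k ` e) ` ({..<\<alpha>} \<times> edges G)"
      by (intro image_eqI[where x = "(k, {u, v})"]) (auto simp: edges_def)
  next
    fix e assume "e \<in> (\<lambda>(k, e). glue c k ` e) ` ({..<\<alpha>} \<times> edges G)"
    then obtain k u v where kuv: "e = glue c k ` {u, v}" "k < \<alpha>" "(u, v) \<in> parcs G"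
      by (auto simp: edges_def)
    then show "e \<in> edges ?H" using arc[OF kuv(2,3)] unfolding edges_def kuv(1) by (simp only: image_insert image_empty) blast
  qed
  ultimately show ?thesis3 by (simp add: card_image card_cartesian_product)
qed

end

theory Submission
  imports Defs
begin

text \<open>
  Write \<open>h x v = E\<^sub>x T\<^sub>v\<close> for the hitting times of \<open>G\<^sub>1\<close>, which has \<open>n\<close> vertices. On a finite
  connected graph, the hitting times of \<open>v\<close> are finite, and by the maximum principle they are the
  only solution of the first-step equations. Guessing a solution therefore identifies the hitting
  times of the composite graph: they equal \<open>h x c\<close> for the target \<open>c\<close>,
  \<open>\<alpha> h x v + (\<alpha> - 1) (h v c - h x c)\<close> inside one copy, and
  \<open>h x c + \<alpha> h c v + (\<alpha> - 1) h v c\<close> between two copies. The check at \<open>c\<close> uses that the expected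
  return time of a regular graph is \<open>n\<close>. With \<open>h v c = h c v\<close> and \<open>S = \<Sum>\<^sub>v h x v\<close>, which does not
  depend on \<open>x\<close>, the sum over all targets becomes a multiple of \<open>S\<close>.
\<close>

section \<open>Vertices, degrees and connectivity\<close>

lemma finite_pverts:
  assumes "finite_simple_connected_graph G"
  shows "finite (pverts G)"
  using assms by (intro card_ge_0_finite) (simp add: finite_simple_connected_graph_def)

lemma neighbors_sym:
  assumes "finite_simple_connected_graph G"
  shows "w \<in> neighbors G v \<longleftrightarrow> v \<in> neighbors G w"
proof -
  interpret pair_graph G using strongly_connected_graph(1)[OF assms] .
  show ?thesis by (auto simp: neighbors_def intro: arcs_symmetric)
qed

lemma vdegree_pos:
  assumes "finite_simple_connected_graph G" "v \<in> pverts G"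
  shows "0 < vdegree G v"
  using neighbors_props[OF assms] by (metis card_gt_0_iff)

text \<open>Induction along a path from \<open>u\<close> to \<open>v\<close>. It spreads finiteness
  of hitting times outward from the target, and carries a maximum to the boundary vertex.\<close>

lemma connected_vertex_induct [consumes 3, case_names base step]:
  assumes G: "finite_simple_connected_graph G" and u: "u \<in> pverts G" and v: "v \<in> pverts G"
    and base: "P u"
    and step: "\<And>x y. x \<in> pverts G \<Longrightarrow> P x \<Longrightarrow> y \<in> neighbors G x \<Longrightarrow> P y"
  shows "P v"
proof -
  interpret pair_graph G using strongly_connected_graph(1)[OF G] .
  have "u \<rightarrow>\<^sup>*\<^bsub>with_proj G\<^esub> v"
    using strongly_connected_graph(2)[OF G] u v by (simp add: strongly_connected_def)
  then show ?thesis
  proof (induction rule: reachable_induct)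
    case base
    then show ?case using \<open>P u\<close> by simp
  next
    case (step x y)
    then have "(x, y) \<in> parcs G" by auto
    then show ?case using assms(5)[of x y] step.IH by (auto simp: neighbors_def dest: in_arcsD1)
  qed
qed

text \<open>Adjacency is symmetric, so each \<open>w\<close> is counted once per neighbor. This is
  stationarity of the degree weights, stated over a semiring to serve both \<open>ennreal\<close>
  and \<open>real\<close>.\<close>

lemma sum_neighbors_swap:
  fixes f :: "'a \<Rightarrow> 'b :: comm_semiring_1"
  assumes G: "finite_simple_connected_graph G"
  shows "(\<Sum>v\<in>pverts G. \<Sum>w\<in>neighbors G v. f w) = (\<Sum>v\<in>pverts G. of_nat (vdegree G v) * f v)"
proof -
  have N: "neighbors G v = {w \<in> pverts G. w \<in> neighbors G v}" if "v \<in> pverts G" for v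
    using neighbors_props(3)[OF G that] by auto
  have "(\<Sum>v\<in>pverts G. \<Sum>w\<in>neighbors G v. f w)
      = (\<Sum>v\<in>pverts G. \<Sum>w\<in>{w \<in> pverts G. w \<in> neighbors G v}. f w)"
    using N by (intro sum.cong) auto
  also have "\<dots> = (\<Sum>w\<in>pverts G. \<Sum>v\<in>{v \<in> pverts G. w \<in> neighbors G v}. f w)"
    by (rule sum.swap_restrict) (simp_all add: finite_pverts[OF G])
  also have "\<dots> = (\<Sum>w\<in>pverts G. of_nat (vdegree G w) * f w)"
  proof (rule sum.cong[OF refl])
    fix w assume w: "w \<in> pverts G"
    have "{v \<in> pverts G. w \<in> neighbors G v} = neighbors G w"
      using N[OF w] neighbors_sym[OF G] by blast
    then show "(\<Sum>v\<in>{v \<in> pverts G. w \<in> neighbors G v}. f w) = of_nat (vdegree G w) * f w"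
      by (simp add: neighbors_props(4)[OF G w])
  qed
  finally show ?thesis .
qed

subsection \<open>First-step analysis and finiteness of hitting times\<close>

lemma hitting_time_same: "X 0 = b \<Longrightarrow> hitting_time X b = 0"
  unfolding hitting_time_def by (rule Inf_eqI) (auto simp: zero_enat_def)

lemma hitting_time_Suc:
  assumes "X 0 \<noteq> b"
  shows "hitting_time X b = eSuc (hitting_time (\<lambda>k. X (Suc k)) b)"
proof (cases "\<exists>k. X (Suc k) = b")
  case True
  define m where "m = (LEAST k. X (Suc k) = b)"
  have m: "X (Suc m) = b" "\<And>k. X (Suc k) = b \<Longrightarrow> m \<le> k"
    using True by (auto simp: m_def intro: LeastI_ex Least_le)
  have "hitting_time (\<lambda>k. X (Suc k)) b = enat m"
    unfolding hitting_time_def using m by (intro Inf_eqI) auto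
  moreover have "hitting_time X b = enat (Suc m)"
    unfolding hitting_time_def
  proof (rule Inf_eqI)
    fix i assume "i \<in> {enat k |k. X k = b}"
    then obtain k where k: "i = enat k" "X k = b" by auto
    with assms obtain l where "k = Suc l" by (cases k) auto
    with k m(2) show "enat (Suc m) \<le> i" by auto
  qed (use m(1) in auto)
  ultimately show ?thesis by (simp add: eSuc_enat)
next
  case False
  then have "X k \<noteq> b" for k using assms by (cases k) auto
  then show ?thesis using False by (simp add: hitting_time_def Inf_enat_def)
qed

text \<open>The marginal of the product measure at \<open>a\<close> is uniform on the neighbors;
  multiplying by the degree avoids division in \<open>ennreal\<close>.\<close>

lemma nn_integral_step:
  fixes F :: "'a \<Rightarrow> ennreal"
  assumes G: "finite_simple_connected_graph G" and a: "a \<in> pverts G"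
  shows "of_nat (vdegree G a) * (\<integral>\<^sup>+f. F (f a) \<partial>step_space G) = (\<Sum>w\<in>neighbors G a. F w)"
proof -
  let ?U = "\<lambda>v. uniform_count_measure (neighbors G v)"
  note N = neighbors_props[OF G a]
  have "distr (step_space G) (?U a) (\<lambda>f. f a) = ?U a"
    unfolding step_space_def
    by (rule distr_PiM_component)
       (intro prob_space_uniform_count_measure neighbors_props G a | assumption)+
  moreover have "(\<lambda>f. f a) \<in> step_space G \<rightarrow>\<^sub>M ?U a"
    unfolding step_space_def using a by measurable
  moreover have "F \<in> borel_measurable (?U a)"
    by (subst measurable_cong_sets[OF sets_uniform_count_measure_count_space refl]) simp
  ultimately have "(\<integral>\<^sup>+f. F (f a) \<partial>step_space G) = integral\<^sup>N (?U a) F"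
    using nn_integral_distr[of "\<lambda>f. f a" "step_space G" "?U a" F] by simp
  also have "\<dots> = ennreal (1 / vdegree G a) * (\<Sum>w\<in>neighbors G a. F w)"
    using N by (simp add: uniform_count_measure_def nn_integral_point_measure_finite sum_distrib_left)
  finally have *: "(\<integral>\<^sup>+f. F (f a) \<partial>step_space G)
    = ennreal (1 / vdegree G a) * (\<Sum>w\<in>neighbors G a. F w)" .
  have "of_nat (vdegree G a) * ennreal (1 / vdegree G a) = 1"
    using vdegree_pos[OF G a]
    by (simp add: ennreal_of_nat_eq_real_of_nat ennreal_mult'[symmetric])
  then show ?thesis by (simp add: * mult.assoc[symmetric])
qed

text \<open>A finite level \<open>K\<close> gives finite values, which can be cancelled; the level
  \<top> gives the hitting time itself, so one first-step equation covers both.\<close>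

definition truncated_hitting_time :: "'a pair_pre_digraph \<Rightarrow> ennreal \<Rightarrow> 'a \<Rightarrow> 'a \<Rightarrow> ennreal" where
  "truncated_hitting_time G K a b =
     (\<integral>\<^sup>+\<omega>. min (ennreal_of_enat (hitting_time (walk a \<omega>) b)) K \<partial>walk_space G)"

lemma truncated_hitting_time_top: "truncated_hitting_time G \<top> a b = expected_hitting_time G a b"
  by (simp add: truncated_hitting_time_def expected_hitting_time_def)

lemma truncated_hitting_time_same: "truncated_hitting_time G K b b = 0"
  by (simp add: truncated_hitting_time_def hitting_time_same)

lemma truncated_hitting_time_mono:
  "K \<le> L \<Longrightarrow> truncated_hitting_time G K a b \<le> truncated_hitting_time G L a b"
  unfolding truncated_hitting_time_def by (intro nn_integral_mono min.mono) auto

lemma truncated_hitting_time_le: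
  assumes "finite_simple_connected_graph G"
  shows "truncated_hitting_time G K a b \<le> K"
proof -
  interpret prob_space "walk_space G" using prob_space_walk_space[OF assms] .
  have "truncated_hitting_time G K a b \<le> (\<integral>\<^sup>+\<omega>. K \<partial>walk_space G)"
    unfolding truncated_hitting_time_def by (intro nn_integral_mono) auto
  then show ?thesis by (simp add: emeasure_space_1)
qed

text \<open>Condition on the first random map: one step is spent, and
  \<open>min (1 + T) (1 + K) = 1 + min T K\<close> lowers the level by one.\<close>

lemma truncated_hitting_time_step:
  assumes G: "finite_simple_connected_graph G" and a: "a \<in> pverts G" and "a \<noteq> b"
  shows "of_nat (vdegree G a) * truncated_hitting_time G (1 + K) a b
           = of_nat (vdegree G a) + (\<Sum>w\<in>neighbors G a. truncated_hitting_time G K w b)"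
proof -
  interpret S: prob_space "step_space G" using prob_space_step[OF G] .
  interpret W: prob_space "walk_space G" using prob_space_walk_space[OF G] .
  let ?T = "\<lambda>a \<omega>. ennreal_of_enat (hitting_time (walk a \<omega>) b)"
  note [measurable] = measurable_hitting_time[OF G]
  have shift: "?T a (f ## \<omega>) = 1 + ?T (f a) \<omega>" for f \<omega>
    using hitting_time_Suc[of "walk a (f ## \<omega>)" b] \<open>a \<noteq> b\<close>
    by (simp add: walk_Stream del: walk.simps(2))
  have "truncated_hitting_time G (1 + K) a b
      = (\<integral>\<^sup>+f. (\<integral>\<^sup>+\<omega>. min (?T a (f ## \<omega>)) (1 + K) \<partial>walk_space G) \<partial>step_space G)"
    unfolding truncated_hitting_time_def using a
    by (subst (1) walk_space_def, subst S.nn_integral_stream_space)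
       (simp_all add: walk_space_def[symmetric])
  also have "\<dots> = (\<integral>\<^sup>+f. 1 + truncated_hitting_time G K (f a) b \<partial>step_space G)"
  proof (rule nn_integral_cong)
    fix f assume "f \<in> space (step_space G)"
    then have fa: "f a \<in> pverts G" using measurable_space[OF measurable_step[OF G a]] by simp
    have "min (?T a (f ## \<omega>)) (1 + K) = 1 + min (?T (f a) \<omega>) K" for \<omega>
      unfolding shift by (rule min_of_mono) (simp add: mono_def add_left_mono)
    then show "(\<integral>\<^sup>+\<omega>. min (?T a (f ## \<omega>)) (1 + K) \<partial>walk_space G) = 1 + truncated_hitting_time G K (f a) b"
      using fa by (simp add: truncated_hitting_time_def nn_integral_add W.emeasure_space_1)
  qed
  finally have "of_nat (vdegree G a) * truncated_hitting_time G (1 + K) a b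
      = (\<Sum>w\<in>neighbors G a. 1 + truncated_hitting_time G K w b)"
    by (simp add: nn_integral_step[OF G a, of "\<lambda>w. 1 + truncated_hitting_time G K w b"])
  then show ?thesis by (simp add: sum.distrib neighbors_props(4)[OF G a])
qed

text \<open>Summing the first-step equations against the degrees, the terms telescope in the truncation
  level, which leaves a bound on the neighbors of the target that does not depend on that level.\<close>

lemma sum_neighbors_truncated_hitting_time_le:
  assumes G: "finite_simple_connected_graph G" and b: "b \<in> pverts G"
  shows "(\<Sum>w\<in>neighbors G b. truncated_hitting_time G (of_nat k) w b)
           \<le> of_nat (\<Sum>a\<in>pverts G. vdegree G a)"
proof -
  let ?t = "\<lambda>k a. truncated_hitting_time G (of_nat k) a b"
  let ?d = "\<lambda>a. of_nat (vdegree G a) :: ennreal"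
  let ?V = "pverts G - {b}"
  let ?A = "\<Sum>a\<in>?V. ?d a * ?t (Suc k) a"
  let ?N = "\<Sum>w\<in>neighbors G b. ?t k w"
  let ?C = "\<Sum>a\<in>?V. \<Sum>w\<in>neighbors G a. ?t k w"
  note fin = finite_pverts[OF G]
  have A: "?A = (\<Sum>a\<in>?V. ?d a) + ?C"
    unfolding sum.distrib[symmetric] of_nat_Suc
    by (intro sum.cong[OF refl] truncated_hitting_time_step[OF G]) auto
  \<comment> \<open>Adding the row of the target completes the double sum, so that it can be
    swapped.\<close>
  have "?N + ?C = (\<Sum>a\<in>pverts G. ?d a * ?t k a)"
    unfolding sum_neighbors_swap[OF G, symmetric] by (rule sum.remove[symmetric, OF fin b])
  also have "\<dots> = (\<Sum>a\<in>?V. ?d a * ?t k a)"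
    by (simp add: sum.remove[OF fin b] truncated_hitting_time_same)
  also have "\<dots> \<le> ?A"
    by (intro sum_mono mult_left_mono truncated_hitting_time_mono) auto
  finally have "(\<Sum>a\<in>?V. ?d a) + (?N + ?C) \<le> (\<Sum>a\<in>?V. ?d a) + ?A"
    by (rule add_left_mono)
  also have "(\<Sum>a\<in>?V. ?d a) + (?N + ?C) = ?A + ?N"
    unfolding A by (simp only: ac_simps)
  also have "(\<Sum>a\<in>?V. ?d a) + ?A = ?A + (\<Sum>a\<in>?V. ?d a)"
    by (rule add.commute)
  finally have le: "?A + ?N \<le> ?A + (\<Sum>a\<in>?V. ?d a)" .
  \<comment> \<open>Cancelling \<open>?A\<close> in \<open>ennreal\<close> requires it to be finite,
    which the truncation guarantees.\<close>
  have fin_t: "?t (Suc k) a < \<top>" for a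
    using truncated_hitting_time_le[OF G] of_nat_less_top by (rule le_less_trans)
  have "?A < \<top>"
    unfolding ennreal_sum_less_top[OF finite_Diff[OF fin]]
    by (intro ballI ennreal_mult_less_top[THEN iffD2] disjI2 conjI of_nat_less_top fin_t)
  with le have "?N \<le> (\<Sum>a\<in>?V. ?d a)"
    unfolding ennreal_add_left_cancel_le infinity_ennreal_def by (metis less_irrefl)
  also have "\<dots> \<le> (\<Sum>a\<in>pverts G. ?d a)"
    by (intro sum_mono2 fin) auto
  finally show ?thesis by simp
qed

text \<open>Monotone convergence: a bound that is uniform in the level passes to the untruncated
  expectation.\<close>

lemma expected_hitting_time_SUP:
  assumes G: "finite_simple_connected_graph G" and a: "a \<in> pverts G"
  shows "expected_hitting_time G a b = (SUP k. truncated_hitting_time G (of_nat k) a b)"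
proof -
  let ?T = "\<lambda>\<omega>. ennreal_of_enat (hitting_time (walk a \<omega>) b)"
  note [measurable] = measurable_hitting_time[OF G a]
  have "min (?T \<omega>) \<top> = (SUP k. min (?T \<omega>) (of_nat k))" for \<omega>
    unfolding ennreal_SUP_of_nat_eq_top[symmetric] inf_min[symmetric] by (rule inf_SUP)
  then have "expected_hitting_time G a b = (\<integral>\<^sup>+\<omega>. (SUP k. min (?T \<omega>) (of_nat k)) \<partial>walk_space G)"
    by (simp add: expected_hitting_time_def)
  also have "\<dots> = (SUP k. truncated_hitting_time G (of_nat k) a b)"
    unfolding truncated_hitting_time_def
  proof (rule nn_integral_monotone_convergence_SUP)
    show "incseq (\<lambda>k \<omega>. min (?T \<omega>) (of_nat k))"
      by (intro incseq_SucI le_funI min.mono order_refl of_nat_mono) simp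
  qed measurable
  finally show ?thesis .
qed

lemma expected_hitting_time_finite:
  assumes G: "finite_simple_connected_graph G" and a: "a \<in> pverts G" and b: "b \<in> pverts G"
  shows "expected_hitting_time G a b < \<top>"
  using G b a
proof (induction rule: connected_vertex_induct)
  case base
  show ?case by (simp add: truncated_hitting_time_top[symmetric] truncated_hitting_time_same)
next
  case (step x y)
  note N = neighbors_props[OF G \<open>x \<in> pverts G\<close>]
  show ?case
  proof (cases "x = b")
    case True
    \<comment> \<open>Next to the target, the level-independent bound applies.\<close>
    have "truncated_hitting_time G (of_nat k) y b \<le> of_nat (\<Sum>a\<in>pverts G. vdegree G a)" for k
    proof -
      have "truncated_hitting_time G (of_nat k) y b
          \<le> (\<Sum>w\<in>neighbors G b. truncated_hitting_time G (of_nat k) w b)"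
        using step.hyps(2) N(1) True by (intro member_le_sum) auto
      also note sum_neighbors_truncated_hitting_time_le[OF G b]
      finally show ?thesis .
    qed
    then have "expected_hitting_time G y b \<le> of_nat (\<Sum>a\<in>pverts G. vdegree G a)"
      using step.hyps(2) N(3) by (subst expected_hitting_time_SUP[OF G]) (auto intro: SUP_least)
    then show ?thesis using of_nat_less_top by (rule le_less_trans)
  next
    case False
    \<comment> \<open>Away from the target, the first-step equation at \<open>x\<close> bounds the
      value at each neighbor by a multiple of the value at \<open>x\<close>.\<close>
    have "expected_hitting_time G y b \<le> (\<Sum>w\<in>neighbors G x. expected_hitting_time G w b)"
      using step.hyps(2) N(1) by (intro member_le_sum) auto
    also have "\<dots> \<le> of_nat (vdegree G x) * expected_hitting_time G x b"
      using truncated_hitting_time_step[OF G step.hyps(1) False, of \<top>]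
      by (simp add: truncated_hitting_time_top)
    also have "\<dots> < \<top>" using step.IH by (simp add: ennreal_mult_less_top of_nat_less_top)
    finally show ?thesis .
  qed
qed

section \<open>Real-valued hitting times and the transition operator\<close>

definition hit :: "'a pair_pre_digraph \<Rightarrow> 'a \<Rightarrow> 'a \<Rightarrow> real" where
  "hit G a b = enn2real (expected_hitting_time G a b)"

definition nbr_avg :: "'a pair_pre_digraph \<Rightarrow> ('a \<Rightarrow> real) \<Rightarrow> 'a \<Rightarrow> real" where
  "nbr_avg G f v = (\<Sum>w\<in>neighbors G v. f w) / real (vdegree G v)"

text \<open>By finiteness, the default value 0 of \<open>enn2real\<close> at \<top> never arises
  here.\<close>

lemma ennreal_hit:
  assumes "finite_simple_connected_graph G" "a \<in> pverts G" "b \<in> pverts G"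
  shows "ennreal (hit G a b) = expected_hitting_time G a b"
  unfolding hit_def using expected_hitting_time_finite[OF assms] by simp

lemma hit_nonneg: "0 \<le> hit G a b"
  by (simp add: hit_def)

lemma hit_same: "hit G b b = 0"
  by (simp add: hit_def truncated_hitting_time_top[symmetric] truncated_hitting_time_same)

lemma hit_step:
  assumes G: "finite_simple_connected_graph G" and a: "a \<in> pverts G" and b: "b \<in> pverts G"
    and "a \<noteq> b"
  shows "hit G a b = 1 + nbr_avg G (\<lambda>w. hit G w b) a"
proof -
  have E: "expected_hitting_time G w b = ennreal (hit G w b)" if "w \<in> neighbors G a" for w
    using ennreal_hit[OF G _ b] neighbors_props(3)[OF G a] that by auto
  have "of_nat (vdegree G a) * ennreal (hit G a b)
      = of_nat (vdegree G a) + (\<Sum>w\<in>neighbors G a. ennreal (hit G w b))"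
    using truncated_hitting_time_step[OF G a \<open>a \<noteq> b\<close>, of \<top>] E
    by (simp add: truncated_hitting_time_top ennreal_hit[OF G a b])
  then have "ennreal (real (vdegree G a) * hit G a b)
      = ennreal (real (vdegree G a) + (\<Sum>w\<in>neighbors G a. hit G w b))"
    by (simp add: ennreal_of_nat_eq_real_of_nat ennreal_mult hit_nonneg sum_nonneg)
  then have "real (vdegree G a) * hit G a b = real (vdegree G a) + (\<Sum>w\<in>neighbors G a. hit G w b)"
    by (subst (asm) ennreal_inj) (auto intro!: add_nonneg_nonneg sum_nonneg mult_nonneg_nonneg hit_nonneg)
  then show ?thesis
    using vdegree_pos[OF G a] by (simp add: nbr_avg_def field_simps)
qed

subsection \<open>Maximum principle\<close>

lemma nbr_avg_diff: "nbr_avg G (\<lambda>x. f x - g x) v = nbr_avg G f v - nbr_avg G g v"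
  by (simp add: nbr_avg_def sum_subtractf diff_divide_distrib)

lemma nbr_avg_add: "nbr_avg G (\<lambda>x. f x + g x) v = nbr_avg G f v + nbr_avg G g v"
  by (simp add: nbr_avg_def sum.distrib add_divide_distrib)

lemma nbr_avg_mult: "nbr_avg G (\<lambda>x. r * f x) v = r * nbr_avg G f v"
  by (simp add: nbr_avg_def sum_distrib_left)

lemma nbr_avg_const:
  assumes "finite_simple_connected_graph G" "v \<in> pverts G"
  shows "nbr_avg G (\<lambda>x. r) v = r"
  using neighbors_props(4)[OF assms] vdegree_pos[OF assms] by (simp add: nbr_avg_def)

lemma nbr_avg_sum: "nbr_avg G (\<lambda>x. \<Sum>j\<in>A. f j x) v = (\<Sum>j\<in>A. nbr_avg G (f j) v)"
  unfolding nbr_avg_def by (subst sum.swap) (simp add: sum_divide_distrib)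

text \<open>Where \<open>u\<close> is harmonic and maximal, the average forces every neighbor to be
  maximal too, so the maximum spreads until it reaches \<open>b\<close>.\<close>

lemma harmonic_le:
  assumes G: "finite_simple_connected_graph G" and b: "b \<in> pverts G" and x: "x \<in> pverts G"
    and harm: "\<And>a. a \<in> pverts G \<Longrightarrow> a \<noteq> b \<Longrightarrow> u a = nbr_avg G u a"
  shows "u x \<le> u b"
proof -
  define M where "M = Max (u ` pverts G)"
  have le: "u y \<le> M" if "y \<in> pverts G" for y
    unfolding M_def using finite_pverts[OF G] that by simp
  have "M \<in> u ` pverts G"
    unfolding M_def using finite_pverts[OF G] x by (intro Max_in) auto
  then obtain z where z: "z \<in> pverts G" "u z = M" by auto
  \<comment> \<open>Harmonicity may fail at \<open>b\<close>; the second disjunct lets the induction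
    continue past \<open>b\<close>.\<close>
  have "u y = M \<or> u b = M" if "y \<in> pverts G" for y using G z(1) that
  proof (induction rule: connected_vertex_induct)
    case base
    show ?case using z(2) by simp
  next
    case (step v w)
    show ?case
    proof (cases "v = b \<or> u b = M")
      case False
      then have v: "v \<noteq> b" "u v = M" using step.IH by auto
      note N = neighbors_props[OF G step.hyps(1)]
      have "(\<Sum>y\<in>neighbors G v. u y) = real (vdegree G v) * M"
        using harm[OF step.hyps(1) v(1)] v(2) vdegree_pos[OF G step.hyps(1)]
        by (simp add: nbr_avg_def field_simps)
      then have "(\<Sum>y\<in>neighbors G v. M - u y) = 0"
        by (simp add: sum_subtractf N(4))
      then have "\<forall>y\<in>neighbors G v. M - u y = 0"
        using N(1,3) le by (subst (asm) sum_nonneg_eq_0_iff) auto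
      then show ?thesis using step.hyps(2) by simp
    qed (use step.IH in auto)
  qed
  from this[OF b] show ?thesis using le[OF x] by simp
qed

lemma harmonic_eq:
  assumes G: "finite_simple_connected_graph G" and b: "b \<in> pverts G" and x: "x \<in> pverts G"
    and harm: "\<And>a. a \<in> pverts G \<Longrightarrow> a \<noteq> b \<Longrightarrow> u a = nbr_avg G u a"
  shows "u x = u b"
proof (rule antisym)
  show "u x \<le> u b" by (rule harmonic_le[OF G b x harm])
  have "- u a = nbr_avg G (\<lambda>y. - u y) a" if "a \<in> pverts G" "a \<noteq> b" for a
    using nbr_avg_mult[of G "-1" u a] harm[OF that] by simp
  then have "- u x \<le> - u b" by (rule harmonic_le[OF G b x])
  then show "u b \<le> u x" by simp
qed

text \<open>The difference of two solutions is harmonic off \<open>b\<close> and vanishes at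
  \<open>b\<close>.\<close>

lemma hit_unique:
  assumes G: "finite_simple_connected_graph G" and b: "b \<in> pverts G" and x: "x \<in> pverts G"
    and "f b = 0"
    and step: "\<And>a. a \<in> pverts G \<Longrightarrow> a \<noteq> b \<Longrightarrow> f a = 1 + nbr_avg G f a"
  shows "hit G x b = f x"
proof -
  have "hit G x b - f x = hit G b b - f b"
  proof (rule harmonic_eq[OF G b x])
    fix a assume "a \<in> pverts G" "a \<noteq> b"
    then show "hit G a b - f a = nbr_avg G (\<lambda>a. hit G a b - f a) a"
      using step hit_step[OF G _ b] by (simp add: nbr_avg_diff)
  qed
  then show ?thesis by (simp add: hit_same \<open>f b = 0\<close>)
qed

subsection \<open>Regular graphs\<close>

text \<open>On a regular graph the uniform distribution is stationary.\<close>

lemma sum_nbr_avg_regular: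
  assumes G: "finite_simple_connected_graph G" and "regular d G"
  shows "(\<Sum>v\<in>pverts G. nbr_avg G f v) = (\<Sum>v\<in>pverts G. f v)"
proof (cases "d = 0")
  case True
  then have "pverts G = {}" using vdegree_pos[OF G] assms(2) by (fastforce simp: regular_def)
  then show ?thesis by simp
next
  case False
  have "(\<Sum>v\<in>pverts G. nbr_avg G f v) = (\<Sum>v\<in>pverts G. \<Sum>w\<in>neighbors G v. f w) / real d"
    using assms(2) by (simp add: nbr_avg_def regular_def sum_divide_distrib)
  also have "\<dots> = (\<Sum>v\<in>pverts G. f v)"
    unfolding sum_neighbors_swap[OF G] using False assms(2)
    by (simp add: regular_def sum_distrib_left[symmetric])
  finally show ?thesis .
qed

text \<open>Kac's formula, less the first step out of \<open>c\<close>. Summing the first-step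
  equations over all starts but \<open>c\<close>, uniform stationarity cancels the sums of hitting
  times.\<close>

lemma return_time_regular:
  assumes G: "finite_simple_connected_graph G" and reg: "regular d G" and c: "c \<in> pverts G"
  shows "nbr_avg G (\<lambda>w. hit G w c) c = real (card (pverts G)) - 1"
proof -
  note fin = finite_pverts[OF G]
  let ?h = "\<lambda>w. hit G w c"
  have "(\<Sum>v\<in>pverts G. ?h v) = (\<Sum>v\<in>pverts G - {c}. 1 + nbr_avg G ?h v)"
    unfolding sum.remove[OF fin c] hit_same
    by (simp, intro sum.cong hit_step[OF G _ c]) auto
  also have "\<dots> = real (card (pverts G)) - 1 + (\<Sum>v\<in>pverts G - {c}. nbr_avg G ?h v)"
    using c fin card_gt_0_iff[of "pverts G"] by (auto simp: sum.distrib card_Diff_singleton of_nat_diff Suc_le_eq)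
  also have "(\<Sum>v\<in>pverts G - {c}. nbr_avg G ?h v) = (\<Sum>v\<in>pverts G. ?h v) - nbr_avg G ?h c"
    using sum_nbr_avg_regular[OF G reg, of ?h] sum.remove[OF fin c, of "nbr_avg G ?h"] by simp
  finally show ?thesis by simp
qed

text \<open>The sum is harmonic at every vertex \<open>a\<close>: averaging lowers each of the
  \<open>n - 1\<close> terms with \<open>v \<noteq> a\<close> by 1, and the return time to
  \<open>a\<close> restores \<open>n - 1\<close>.\<close>

lemma random_target_regular:
  assumes G: "finite_simple_connected_graph G" and reg: "regular d G"
    and x: "x \<in> pverts G" and y: "y \<in> pverts G"
  shows "(\<Sum>v\<in>pverts G. hit G x v) = (\<Sum>v\<in>pverts G. hit G y v)"
proof (rule harmonic_eq[OF G y x])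
  fix a assume a: "a \<in> pverts G"
  note fin = finite_pverts[OF G]
  have "nbr_avg G (\<lambda>x. \<Sum>v\<in>pverts G. hit G x v) a
      = nbr_avg G (\<lambda>x. hit G x a) a + (\<Sum>v\<in>pverts G - {a}. nbr_avg G (\<lambda>x. hit G x v) a)"
    unfolding nbr_avg_sum by (rule sum.remove[OF fin a])
  also have "(\<Sum>v\<in>pverts G - {a}. nbr_avg G (\<lambda>x. hit G x v) a) = (\<Sum>v\<in>pverts G - {a}. hit G a v - 1)"
    using hit_step[OF G a] by (intro sum.cong) auto
  also have "\<dots> = (\<Sum>v\<in>pverts G. hit G a v) - (real (card (pverts G)) - 1)"
    using a fin card_gt_0_iff[of "pverts G"]
    by (auto simp: sum_subtractf card_Diff_singleton of_nat_diff Suc_le_eq sum.remove[OF fin a] hit_same)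
  finally show "(\<Sum>v\<in>pverts G. hit G a v) = nbr_avg G (\<lambda>x. \<Sum>v\<in>pverts G. hit G x v) a"
    by (simp add: return_time_regular[OF G reg a])
qed

lemma kemeny_eq:
  assumes G: "finite_simple_connected_graph G" and i: "i \<in> pverts G"
  shows "kemeny G i = ennreal (\<Sum>j\<in>pverts G. stationary G j * hit G i j)"
proof -
  have "stationary G j \<ge> 0" for j by (simp add: stationary_def)
  then have "kemeny G i = (\<Sum>j\<in>pverts G. ennreal (stationary G j * hit G i j))"
    unfolding kemeny_def using i
    by (intro sum.cong) (simp_all add: ennreal_mult hit_nonneg ennreal_hit[OF G])
  also have "\<dots> = ennreal (\<Sum>j\<in>pverts G. stationary G j * hit G i j)"
    by (rule sum_ennreal) (simp add: stationary_def hit_nonneg)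
  finally show ?thesis .
qed

subsection \<open>The composite graph\<close>

context
  fixes G :: "'a pair_pre_digraph" and c :: 'a and \<alpha> :: nat
  assumes G: "finite_simple_connected_graph G" and c: "c \<in> pverts G" and \<alpha>: "1 \<le> \<alpha>"
begin

section \<open>Neighbors, degrees and stationary weights of the composite graph\<close>

lemma glue_in_composite: "k < \<alpha> \<Longrightarrow> v \<in> pverts G \<Longrightarrow> glue c k v \<in> pverts (composite G c \<alpha>)"
  by (auto simp: composite_def)

lemma pverts_composite:
  "pverts (composite G c \<alpha>) = insert (0, c) ({..<\<alpha>} \<times> (pverts G - {c}))"
proof (intro equalityI subsetI)
  fix y assume "y \<in> insert (0, c) ({..<\<alpha>} \<times> (pverts G - {c}))"
  then have "y = glue c 0 c \<or> y = glue c (fst y) (snd y) \<and> fst y < \<alpha> \<and> snd y \<in> pverts G"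
    by (auto simp: glue_def)
  then show "y \<in> pverts (composite G c \<alpha>)"
    using glue_in_composite[of 0 c] glue_in_composite[of "fst y" "snd y"] c \<alpha> by auto
qed (auto simp: composite_def glue_def split: if_splits)

lemma composite_vertex_cases:
  assumes "y \<in> pverts (composite G c \<alpha>)"
  obtains (center) "y = (0, c)"
    | (other) k v where "y = (k, v)" "k < \<alpha>" "v \<in> pverts G" "v \<noteq> c"
  using assms unfolding pverts_composite by auto

lemma neighbors_composite_other:
  assumes "k < \<alpha>" "v \<noteq> c"
  shows "neighbors (composite G c \<alpha>) (k, v) = glue c k ` neighbors G v"
  using assms by (auto simp: neighbors_def composite_def glue_def split: if_splits)

lemma neighbors_composite_center:
  "neighbors (composite G c \<alpha>) (0, c) = (\<Union>k<\<alpha>. glue c k ` neighbors G c)"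
  by (fastforce simp: neighbors_def composite_def glue_def split: if_splits)

lemma not_in_neighbors_self: "c \<notin> neighbors G c"
proof -
  interpret pair_graph G using strongly_connected_graph(1)[OF G] .
  show ?thesis by (auto simp: neighbors_def dest: no_loops')
qed

lemma sum_neighbors_composite_center:
  "(\<Sum>w\<in>neighbors (composite G c \<alpha>) (0, c). f w) = (\<Sum>k<\<alpha>. \<Sum>w\<in>neighbors G c. f (glue c k w))"
proof -
  have "(\<Sum>w\<in>neighbors (composite G c \<alpha>) (0, c). f w)
      = (\<Sum>k<\<alpha>. \<Sum>w\<in>glue c k ` neighbors G c. f w)"
    unfolding neighbors_composite_center
  proof (rule sum.UNION_disjoint)
    \<comment> \<open>Distinct copies meet only in the center, and \<open>c\<close> is not its own
      neighbor.\<close>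
    show "\<forall>k\<in>{..<\<alpha>}. \<forall>l\<in>{..<\<alpha>}. k \<noteq> l \<longrightarrow>
        glue c k ` neighbors G c \<inter> glue c l ` neighbors G c = {}"
      using not_in_neighbors_self by (auto simp: glue_def split: if_splits)
  qed (simp_all add: neighbors_props(1)[OF G c])
  also have "\<dots> = (\<Sum>k<\<alpha>. \<Sum>w\<in>neighbors G c. f (glue c k w))"
    by (intro sum.cong refl) (subst sum.reindex, auto simp: inj_on_def glue_inj)
  finally show ?thesis .
qed

lemma vdegree_composite_other:
  assumes "k < \<alpha>" "v \<in> pverts G" "v \<noteq> c"
  shows "vdegree (composite G c \<alpha>) (k, v) = vdegree G v"
proof -
  have "vdegree (composite G c \<alpha>) (k, v) = card (glue c k ` neighbors G v)"
    using assms neighbors_props(4)[OF finite_simple_connected_graph_composite[OF G c \<alpha>], of "(k, v)"]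
    by (simp add: neighbors_composite_other pverts_composite)
  also have "\<dots> = card (neighbors G v)"
    by (rule card_image) (simp add: inj_on_def glue_inj)
  finally show ?thesis using neighbors_props(4)[OF G assms(2)] by simp
qed

lemma vdegree_composite_center: "vdegree (composite G c \<alpha>) (0, c) = \<alpha> * vdegree G c"
proof -
  have "vdegree (composite G c \<alpha>) (0, c) = card (neighbors (composite G c \<alpha>) (0, c))"
    using neighbors_props(4)[OF finite_simple_connected_graph_composite[OF G c \<alpha>], of "(0, c)"]
    by (simp add: pverts_composite)
  also have "\<dots> = \<alpha> * vdegree G c"
    unfolding card_eq_sum sum_neighbors_composite_center by (simp add: neighbors_props(4)[OF G c])
  finally show ?thesis .
qed

lemma nbr_avg_composite_other:
  assumes "k < \<alpha>" "v \<in> pverts G" "v \<noteq> c"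
  shows "nbr_avg (composite G c \<alpha>) f (k, v) = nbr_avg G (\<lambda>x. f (glue c k x)) v"
proof -
  have "(\<Sum>w\<in>glue c k ` neighbors G v. f w) = (\<Sum>w\<in>neighbors G v. f (glue c k w))"
    by (subst sum.reindex) (auto simp: inj_on_def glue_inj)
  then show ?thesis
    using assms by (simp add: nbr_avg_def vdegree_composite_other neighbors_composite_other)
qed

text \<open>From the center, the walk enters each copy with probability
  \<open>1 / \<alpha>\<close>.\<close>

lemma nbr_avg_composite_center:
  "nbr_avg (composite G c \<alpha>) f (0, c) = (\<Sum>k<\<alpha>. nbr_avg G (\<lambda>x. f (glue c k x)) c) / real \<alpha>"
  by (simp add: nbr_avg_def sum_neighbors_composite_center vdegree_composite_center
      sum_divide_distrib mult.commute)

lemma stationary_composite_other: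
  assumes "k < \<alpha>" "v \<in> pverts G" "v \<noteq> c"
  shows "stationary (composite G c \<alpha>) (k, v) = stationary G v / real \<alpha>"
  by (simp add: stationary_def vdegree_composite_other[OF assms] card_edges_composite[OF G c \<alpha>])

text \<open>At the center the degree grows by the same factor \<alpha> as the number of
  edges.\<close>

lemma stationary_composite_center: "stationary (composite G c \<alpha>) (0, c) = stationary G c"
  using \<alpha> by (simp add: stationary_def vdegree_composite_center card_edges_composite[OF G c \<alpha>])

section \<open>Hitting times of the composite graph\<close>

lemma hit_composite_center:
  assumes "k < \<alpha>" "x \<in> pverts G"
  shows "hit (composite G c \<alpha>) (glue c k x) (0, c) = hit G x c"
proof -
  \<comment> \<open>Until it reaches the center the walk stays in one copy, so the copy index can be
    forgotten.\<close>
  let ?f = "\<lambda>y. hit G (snd y) c"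
  have snd_glue: "snd (glue c k x) = x" for k x
    by (simp add: glue_def)
  have "hit (composite G c \<alpha>) (glue c k x) (0, c) = ?f (glue c k x)"
  proof (rule hit_unique[OF finite_simple_connected_graph_composite[OF G c \<alpha>]])
    show "(0, c) \<in> pverts (composite G c \<alpha>)" by (simp add: pverts_composite)
    show "glue c k x \<in> pverts (composite G c \<alpha>)" using assms by (rule glue_in_composite)
    fix y assume "y \<in> pverts (composite G c \<alpha>)" "y \<noteq> (0, c)"
    then show "?f y = 1 + nbr_avg (composite G c \<alpha>) ?f y"
      by (cases y rule: composite_vertex_cases)
         (simp_all add: nbr_avg_composite_other snd_glue hit_step[OF G _ c])
  qed (simp add: hit_same)
  then show ?thesis by (simp add: snd_glue)
qed

text \<open>For a walk killed at \<open>v\<close>, the expected number of visits to \<open>c\<close> from \<open>x\<close> is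
  \<open>\<pi>\<^sub>c (h x v + h v c - h x c)\<close> with \<open>\<pi>\<^sub>c = 1 / n\<close>, and each visit to \<open>c\<close> costs on average
  \<open>(\<alpha> - 1) n\<close> additional steps in the other copies. This gives the first case.\<close>

lemma hit_composite_other:
  assumes reg: "regular d G" and k: "k < \<alpha>" and v: "v \<in> pverts G" "v \<noteq> c"
    and l: "l < \<alpha>" and x: "x \<in> pverts G"
  shows "hit (composite G c \<alpha>) (glue c l x) (k, v) =
    (if l = k then real \<alpha> * hit G x v + (real \<alpha> - 1) * (hit G v c - hit G x c)
     else hit G x c + real \<alpha> * hit G c v + (real \<alpha> - 1) * hit G v c)"
proof -
  define P where "P x = real \<alpha> * hit G x v + (real \<alpha> - 1) * (hit G v c - hit G x c)" for x
  \<comment> \<open>A walk from another copy must pass through the center, so \<open>Q x\<close> is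
    \<open>hit G x c + P c\<close>.\<close>
  define Q where "Q x = hit G x c + (real \<alpha> * hit G c v + (real \<alpha> - 1) * hit G v c)" for x
  define f where "f y = (if fst y = k then P (snd y) else Q (snd y))" for y
  \<comment> \<open>The center carries index 0, so \<open>f\<close> reads it through
    \<open>P\<close> or \<open>Q\<close> depending on whether \<open>k = 0\<close>; both must give
    the same value.\<close>
  have PQ: "P c = Q c" by (simp add: P_def Q_def hit_same)
  then have f_glue: "f (glue c l x) = (if l = k then P x else Q x)" for l x
    by (simp add: f_def glue_def)
  have avgP: "nbr_avg G P y = real \<alpha> * nbr_avg G (\<lambda>x. hit G x v) y
      + (real \<alpha> - 1) * (hit G v c - nbr_avg G (\<lambda>x. hit G x c) y)" if "y \<in> pverts G" for y
    unfolding P_def by (simp add: nbr_avg_add nbr_avg_mult nbr_avg_diff nbr_avg_const[OF G that])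
  have avgQ: "nbr_avg G Q y = nbr_avg G (\<lambda>x. hit G x c) y
      + (real \<alpha> * hit G c v + (real \<alpha> - 1) * hit G v c)" if "y \<in> pverts G" for y
    unfolding Q_def by (simp add: nbr_avg_add nbr_avg_const[OF G that])
  have "hit (composite G c \<alpha>) (glue c l x) (k, v) = f (glue c l x)"
  proof (rule hit_unique[OF finite_simple_connected_graph_composite[OF G c \<alpha>]])
    show "(k, v) \<in> pverts (composite G c \<alpha>)" using k v by (simp add: pverts_composite)
    show "glue c l x \<in> pverts (composite G c \<alpha>)" using l x by (rule glue_in_composite)
    show "f (k, v) = 0" by (simp add: f_def P_def hit_same)
    fix y assume "y \<in> pverts (composite G c \<alpha>)" and y: "y \<noteq> (k, v)"
    then show "f y = 1 + nbr_avg (composite G c \<alpha>) f y"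
    proof (cases y rule: composite_vertex_cases)
      case center
      have hcv: "nbr_avg G (\<lambda>x. hit G x v) c = hit G c v - 1"
        using hit_step[OF G c v(1)] v(2) by simp
      have "(\<Sum>m<\<alpha>. nbr_avg G (\<lambda>x. f (glue c m x)) c)
          = (\<Sum>m<\<alpha>. if m = k then nbr_avg G P c else nbr_avg G Q c)"
        by (intro sum.cong) (simp_all add: f_glue)
      also have "\<dots> = nbr_avg G P c + (real \<alpha> - 1) * nbr_avg G Q c"
        using k \<alpha> by (simp add: sum.remove[of _ k] of_nat_diff)
      \<comment> \<open>The return-time terms enter with weight \<open>-(\<alpha> - 1)\<close> from
        copy \<open>k\<close> and \<open>\<alpha> - 1\<close> from the other copies, and
        cancel.\<close>
      also have "\<dots> = real \<alpha> * (P c - 1)"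
        unfolding avgP[OF c] avgQ[OF c] hcv return_time_regular[OF G reg c]
        by (simp add: P_def hit_same algebra_simps)
      finally have "nbr_avg (composite G c \<alpha>) f (0, c) = P c - 1"
        using \<alpha> by (simp add: nbr_avg_composite_center)
      then show ?thesis using PQ by (simp add: center f_def)
    next
      case (other m u)
      have huc: "nbr_avg G (\<lambda>x. hit G x c) u = hit G u c - 1"
        using hit_step[OF G other(3) c other(4)] by simp
      show ?thesis
      proof (cases "m = k")
        case True
        then have "u \<noteq> v" using y other(1) by simp
        then have "nbr_avg G (\<lambda>x. hit G x v) u = hit G u v - 1"
          using hit_step[OF G other(3) v(1)] by simp
        \<comment> \<open>The coefficients \<alpha> and \<open>-(\<alpha> - 1)\<close> in
          \<open>P\<close> add up to 1, so a drop of 1 in both hitting times is a drop of 1 in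
          \<open>P\<close>.\<close>
        then show ?thesis
          using True other avgP[OF other(3)] huc
          by (simp add: nbr_avg_composite_other f_glue) (simp add: f_def P_def algebra_simps)
      next
        case False
        then show ?thesis
          using other avgQ[OF other(3)] huc
          by (simp add: nbr_avg_composite_other f_glue) (simp add: f_def Q_def)
      qed
    qed
  qed
  then show ?thesis by (simp add: f_glue P_def Q_def)
qed

text \<open>The factor \<alpha> at the center is its stationary weight relative to the other
  vertices. Symmetry merges the two directions between \<open>c\<close> and \<open>v\<close> into
  \<open>(2 * \<alpha> - 1) * hit G c v\<close>.\<close>

lemma sum_hit_composite:
  assumes reg: "regular d G" and sym: "\<And>v. v \<in> pverts G \<Longrightarrow> hit G v c = hit G c v"
    and k: "k < \<alpha>" and x: "x \<in> pverts G"
  shows "real \<alpha> * hit G x c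
      + (\<Sum>l<\<alpha>. \<Sum>v\<in>pverts G - {c}. hit (composite G c \<alpha>) (glue c k x) (l, v))
    = real \<alpha> * ((2 * real \<alpha> - 1) * (\<Sum>v\<in>pverts G. hit G x v))"
proof -
  let ?V = "pverts G - {c}"
  note fin = finite_pverts[OF G]
  define S m where "S = (\<Sum>v\<in>pverts G. hit G x v)" and "m = real (card ?V)"
  \<comment> \<open>Constancy of the random target sum moves the start from \<open>x\<close> to
    \<open>c\<close>.\<close>
  have S: "(\<Sum>v\<in>?V. hit G c v) = S"
    unfolding S_def random_target_regular[OF G reg x c] by (simp add: sum.remove[OF fin c] hit_same)
  have Sx: "(\<Sum>v\<in>?V. hit G x v) = S - hit G x c"
    unfolding S_def by (simp add: sum.remove[OF fin c])
  have own: "(\<Sum>v\<in>?V. hit (composite G c \<alpha>) (glue c k x) (k, v))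
      = real \<alpha> * (S - hit G x c) + (real \<alpha> - 1) * (S - m * hit G x c)"
  proof -
    have "(\<Sum>v\<in>?V. hit (composite G c \<alpha>) (glue c k x) (k, v))
        = (\<Sum>v\<in>?V. real \<alpha> * hit G x v + (real \<alpha> - 1) * (hit G c v - hit G x c))"
      using hit_composite_other[OF reg k _ _ k x] sym by (intro sum.cong) auto
    also have "\<dots> = real \<alpha> * (\<Sum>v\<in>?V. hit G x v) + (real \<alpha> - 1) * ((\<Sum>v\<in>?V. hit G c v) - m * hit G x c)"
      by (simp add: sum.distrib sum_distrib_left[symmetric] sum_subtractf m_def)
    finally show ?thesis by (simp only: S Sx)
  qed
  have others: "(\<Sum>v\<in>?V. hit (composite G c \<alpha>) (glue c k x) (l, v))
      = m * hit G x c + (2 * real \<alpha> - 1) * S" if "l < \<alpha>" "l \<noteq> k" for l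
  proof -
    have "(\<Sum>v\<in>?V. hit (composite G c \<alpha>) (glue c k x) (l, v))
        = (\<Sum>v\<in>?V. hit G x c + (2 * real \<alpha> - 1) * hit G c v)"
      using hit_composite_other[OF reg that(1) _ _ k x] sym that(2)
      by (intro sum.cong) (auto simp: algebra_simps)
    also have "\<dots> = m * hit G x c + (2 * real \<alpha> - 1) * (\<Sum>v\<in>?V. hit G c v)"
      by (simp add: sum.distrib sum_distrib_left[symmetric] m_def)
    finally show ?thesis by (simp only: S)
  qed
  have "(\<Sum>l<\<alpha>. \<Sum>v\<in>?V. hit (composite G c \<alpha>) (glue c k x) (l, v))
      = (real \<alpha> * (S - hit G x c) + (real \<alpha> - 1) * (S - m * hit G x c))
        + (real \<alpha> - 1) * (m * hit G x c + (2 * real \<alpha> - 1) * S)"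
  proof -
    have "(\<Sum>l\<in>{..<\<alpha>} - {k}. \<Sum>v\<in>?V. hit (composite G c \<alpha>) (glue c k x) (l, v))
        = (real \<alpha> - 1) * (m * hit G x c + (2 * real \<alpha> - 1) * S)"
      using k \<alpha> by (simp add: others of_nat_diff)
    then show ?thesis
      using k own by (subst sum.remove[of _ k]) simp_all
  qed
  \<comment> \<open>All multiples of \<open>hit G x c\<close> cancel, and only those of
    \<open>S\<close> remain.\<close>
  then show ?thesis unfolding S_def[symmetric] by (simp add: algebra_simps)
qed

end

theorem proposition4:
  fixes G1 :: "'a pair_pre_digraph" and c :: 'a and d \<alpha> :: nat
  assumes "finite_simple_connected_graph G1"
    and "regular d G1"
    and "highly_symmetric G1"
    and "c \<in> pverts G1"
    and "1 \<le> \<alpha>"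
    and "i \<in> pverts (composite G1 c \<alpha>)"
    and "i1 \<in> pverts G1"
  shows "kemeny (composite G1 c \<alpha>) i = of_nat (2 * \<alpha> - 1) * kemeny G1 i1"
proof -
  note G = assms(1) and reg = assms(2) and c = assms(4) and \<alpha> = assms(5)
  let ?H = "composite G1 c \<alpha>"
  obtain k x where i: "i = glue c k x" and k: "k < \<alpha>" and x: "x \<in> pverts G1"
    using assms(6) by (auto simp: composite_def)
  \<comment> \<open>Regularity gives all vertices of \<open>G1\<close> this same stationary
    weight.\<close>
  define p where "p = real d / (2 * real (card (edges G1)))"
  have p: "stationary G1 v = p" if "v \<in> pverts G1" for v
    using reg that by (simp add: regular_def stationary_def p_def)
  have sym: "hit G1 v c = hit G1 c v" if "v \<in> pverts G1" for v
    using assms(3) c that by (simp add: hit_def highly_symmetric_def)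
  have "(\<Sum>j\<in>pverts ?H. stationary ?H j * hit ?H i j)
      = p * hit G1 x c + (\<Sum>(l, v)\<in>{..<\<alpha>} \<times> (pverts G1 - {c}). p / real \<alpha> * hit ?H i (l, v))"
  proof -
    have "(\<Sum>j\<in>{..<\<alpha>} \<times> (pverts G1 - {c}). stationary ?H j * hit ?H i j)
        = (\<Sum>(l, v)\<in>{..<\<alpha>} \<times> (pverts G1 - {c}). p / real \<alpha> * hit ?H i (l, v))"
    proof (rule sum.cong[OF refl])
      fix j assume "j \<in> {..<\<alpha>} \<times> (pverts G1 - {c})"
      then obtain l v where "j = (l, v)" "l < \<alpha>" "v \<in> pverts G1" "v \<noteq> c" by auto
      then show "stationary ?H j * hit ?H i j = (case j of (l, v) \<Rightarrow> p / real \<alpha> * hit ?H i (l, v))"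
        by (simp add: stationary_composite_other[OF G c \<alpha>] p)
    qed
    then show ?thesis
      using finite_pverts[OF G] hit_composite_center[OF G c \<alpha> k x]
      by (simp add: pverts_composite[OF G c \<alpha>] stationary_composite_center[OF G c \<alpha>] p[OF c] i)
  qed
  also have "\<dots> = p / real \<alpha> * (real \<alpha> * hit G1 x c
      + (\<Sum>l<\<alpha>. \<Sum>v\<in>pverts G1 - {c}. hit ?H i (l, v)))"
    using \<alpha> by (simp add: sum.cartesian_product sum_distrib_left sum_divide_distrib distrib_left)
  \<comment> \<open>Since \<alpha> is at least 1, the natural-number subtraction agrees with the
    real one.\<close>
  also have "\<dots> = real (2 * \<alpha> - 1) * (p * (\<Sum>v\<in>pverts G1. hit G1 x v))"
    using \<alpha> sum_hit_composite[OF G c \<alpha> reg _ k x] sym by (simp add: i of_nat_diff)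
  \<comment> \<open>The random target sum is the same from \<open>x\<close> as from
    \<open>i1\<close>.\<close>
  also have "p * (\<Sum>v\<in>pverts G1. hit G1 x v) = (\<Sum>v\<in>pverts G1. stationary G1 v * hit G1 i1 v)"
    by (simp add: random_target_regular[OF G reg x assms(7)] sum_distrib_left p)
  finally have "(\<Sum>j\<in>pverts ?H. stationary ?H j * hit ?H i j)
      = real (2 * \<alpha> - 1) * (\<Sum>v\<in>pverts G1. stationary G1 v * hit G1 i1 v)" .
  then show ?thesis
    unfolding kemeny_eq[OF finite_simple_connected_graph_composite[OF G c \<alpha>] assms(6)]
      kemeny_eq[OF G assms(7)]
    by (simp add: ennreal_mult' ennreal_of_nat_eq_real_of_nat del: of_nat_diff)
qed

end
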